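(* Let $\mathbf{K}$ be a class of finite lattices which is a variety or a quasi-variety. If $\mathcal{P}\in\mathbf{K}$, then $\mathcal{P}^{[m]}\in\mathbf{K}$ for every integer $m>0$, where $\mathcal{P}^{[m]}$ is the poset of $m$-multichains of $\mathcal{P}$.
   Context: For a finite poset $\mathcal{P}=(P,\leq)$ and an integer $m>0$, let $P^{[m]}=\{(x_1,\ldots,x_m)\in P^m\mid x_1\leq x_2\leq\cdots\leq x_m\}$ be the set of $m$-multichains. The poset of $m$-multichains is $\mathcal{P}^{[m]}=(P^{[m]},\leq)$ with the componentwise order: $(x_1,\ldots,x_m)\leq(y_1,\ldots,y_m)$ if and only if $x_i\leq y_i$ for all $i\in\{1,\ldots,m\}$. A lattice is a poset in which every two elements have a meet (greatest lower bound) $\wedge$ and a join (least upper bound) $\vee$. Lattice terms are the formal expressions built recursively from variables using finite meets $(t_1\wedge\cdots\wedge t_s)$ and finite joins $(t_1\vee\cdots\vee t_s)$. A quasi-identity is an implication of the form "$s_1=t_1$ and $s_2=t_2$ and $\ldots$ and $s_n=t_n$ imply $s=t$", where $n\geq 0$ and $s_1,\ldots,s_n,t_1,\ldots,t_n,s,t$ are lattice terms; if $n=0$ it is called an identity. A lattice satisfies a (quasi-)identity if it holds for all assignments of lattice elements to the variables. A class $\mathbf{K}$ of finite lattices is a variety (respectively, quasi-variety) if there is a set $\Sigma$ of identities (respectively, quasi-identities) such that $\mathbf{K}$ consists exactly of the finite lattices satisfying all members of $\Sigma$. *)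

theory Defs
  imports "HOL-Algebra.Lattice"
begin

definition finite_lattice :: "'a gorder \<Rightarrow> bool" where
  "finite_lattice L \<longleftrightarrow> lattice L \<and> finite (carrier L)"

definition multichains :: "'a gorder \<Rightarrow> nat \<Rightarrow> 'a list set" where
  "multichains P m =
     {xs. length xs = m \<and> set xs \<subseteq> carrier P \<and> successively (\<lambda>x y. x \<sqsubseteq>\<^bsub>P\<^esub> y) xs}"

definition multichain_poset :: "'a gorder \<Rightarrow> nat \<Rightarrow> 'a list gorder" where
  "multichain_poset P m =
     \<lparr> carrier = multichains P m, eq = (=), le = list_all2 (\<lambda>x y. x \<sqsubseteq>\<^bsub>P\<^esub> y) \<rparr>"

text \<open>
  Lattice terms over countably many variables.  Meets and joins have arbitrary finite arity
  at least one: \<open>Meet t ts\<close> stands for the meet of the list \<open>t # ts\<close>.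
\<close>

datatype lterm = Var nat | Meet lterm "lterm list" | Join lterm "lterm list"

primrec lterm_value :: "'a gorder \<Rightarrow> (nat \<Rightarrow> 'a) \<Rightarrow> lterm \<Rightarrow> 'a" where
  "lterm_value L a (Var i) = a i"
| "lterm_value L a (Meet t ts) = \<Sqinter>\<^bsub>L\<^esub> (insert (lterm_value L a t) (set (map (lterm_value L a) ts)))"
| "lterm_value L a (Join t ts) = \<Squnion>\<^bsub>L\<^esub> (insert (lterm_value L a t) (set (map (lterm_value L a) ts)))"

text \<open>
  \<open>Quasi_Identity [(s1, t1), ..., (sn, tn)] (s, t)\<close> is the implication
  ``s1 = t1 and ... and sn = tn imply s = t''.
\<close>

datatype quasi_identity =
  Quasi_Identity (qi_premises: "(lterm \<times> lterm) list") (qi_conclusion: "lterm \<times> lterm")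

definition is_identity :: "quasi_identity \<Rightarrow> bool" where
  "is_identity q \<longleftrightarrow> qi_premises q = []"

definition equation_holds :: "'a gorder \<Rightarrow> (nat \<Rightarrow> 'a) \<Rightarrow> lterm \<times> lterm \<Rightarrow> bool" where
  "equation_holds L a e \<longleftrightarrow> lterm_value L a (fst e) = lterm_value L a (snd e)"

definition satisfies :: "'a gorder \<Rightarrow> quasi_identity \<Rightarrow> bool" where
  "satisfies L q \<longleftrightarrow>
     (\<forall>a. range a \<subseteq> carrier L \<longrightarrow>
        (\<forall>e \<in> set (qi_premises q). equation_holds L a e) \<longrightarrow> equation_holds L a (qi_conclusion q))"

definition finite_models :: "quasi_identity set \<Rightarrow> 'a gorder set" where
  "finite_models \<Sigma> = {L. finite_lattice L \<and> (\<forall>q \<in> \<Sigma>. satisfies L q)}"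

text \<open>
  A class of finite lattices is represented by its members with carrier a set of natural numbers.
  Every finite lattice is isomorphic to such a lattice, and varieties and quasi-varieties are
  closed under isomorphism.  A lattice over an arbitrary type belongs to the class if it is
  isomorphic to one of these members; by \<open>in_class_finite_models\<close> below, for (quasi-)varieties
  this is the same as satisfying the defining (quasi-)identities.
\<close>

type_synonym lattice_class = "nat gorder set"

definition variety :: "lattice_class \<Rightarrow> bool" where
  "variety K \<longleftrightarrow> (\<exists>\<Sigma>. (\<forall>q \<in> \<Sigma>. is_identity q) \<and> K = finite_models \<Sigma>)"

definition quasi_variety :: "lattice_class \<Rightarrow> bool" where
  "quasi_variety K \<longleftrightarrow> (\<exists>\<Sigma>. K = finite_models \<Sigma>)"

definition order_iso :: "'a gorder \<Rightarrow> 'b gorder \<Rightarrow> ('a \<Rightarrow> 'b) \<Rightarrow> bool" where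
  "order_iso L M f \<longleftrightarrow> order_emb L M f \<and> bij_betw f (carrier L) (carrier M)"

definition in_class :: "'a gorder \<Rightarrow> lattice_class \<Rightarrow> bool" where
  "in_class L K \<longleftrightarrow> finite_lattice L \<and> (\<exists>M \<in> K. \<exists>f. order_iso L M f)"

lemma order_iso_inf:
  assumes L: "finite_lattice L" and M: "finite_lattice M" and f: "order_iso L M f"
    and A: "finite A" "A \<noteq> {}" "A \<subseteq> carrier L"
  shows "\<Sqinter>\<^bsub>M\<^esub> (f ` A) = f (\<Sqinter>\<^bsub>L\<^esub> A)"
proof -
  interpret L: lattice L using L by (simp add: finite_lattice_def)
  interpret M: lattice M using M by (simp add: finite_lattice_def)
  have le: "\<And>x y. x \<in> carrier L \<Longrightarrow> y \<in> carrier L \<Longrightarrow> f x \<sqsubseteq>\<^bsub>M\<^esub> f y \<longleftrightarrow> x \<sqsubseteq>\<^bsub>L\<^esub> y"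
    and im: "f ` carrier L = carrier M"
    using f by (auto simp: order_iso_def order_emb_def bij_betw_def)
  have g: "greatest L (\<Sqinter>\<^bsub>L\<^esub> A) (Lower L A)" using L.finite_inf_greatest A by blast
  hence c: "\<Sqinter>\<^bsub>L\<^esub> A \<in> carrier L" by simp
  have fA: "f ` A \<subseteq> carrier M" using A im by blast
  have "greatest M (f (\<Sqinter>\<^bsub>L\<^esub> A)) (Lower M (f ` A))"
  proof (rule greatest_LowerI)
    fix y assume "y \<in> f ` A"
    then show "f (\<Sqinter>\<^bsub>L\<^esub> A) \<sqsubseteq>\<^bsub>M\<^esub> y"
      using g A c le greatest_Lower_below by (metis imageE subsetD)
  next
    fix y assume y: "y \<in> Lower M (f ` A)"
    then have "y \<in> f ` carrier L" unfolding im by (simp add: Lower_def)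
    then obtain x where x: "x \<in> carrier L" "y = f x" by blast
    have "x \<in> Lower L A"
    proof (rule Lower_memI)
      fix z assume z: "z \<in> A"
      then have "y \<sqsubseteq>\<^bsub>M\<^esub> f z" using y fA by (auto simp: Lower_def)
      then show "x \<sqsubseteq>\<^bsub>L\<^esub> z" using x z A le by auto
    qed (rule x)
    then show "y \<sqsubseteq>\<^bsub>M\<^esub> f (\<Sqinter>\<^bsub>L\<^esub> A)" using greatest_le[OF g] x c le by auto
  qed (use fA c im in auto)
  moreover have "greatest M (\<Sqinter>\<^bsub>M\<^esub> (f ` A)) (Lower M (f ` A))"
    using M.finite_inf_greatest fA A by blast
  ultimately show ?thesis using M.greatest_unique by blast
qed

lemma finite_lattice_dual: "finite_lattice L \<Longrightarrow> finite_lattice (inv_gorder L)"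
  unfolding finite_lattice_def
proof safe
  assume "lattice L"
  then interpret lattice L .
  interpret D: partial_order "inv_gorder L" by (rule dual_order)
  show "lattice (inv_gorder L)"
    by unfold_locales (simp_all add: sup_of_two_exists inf_of_two_exists)
qed auto

lemma order_iso_dual: "order_iso L M f \<Longrightarrow> order_iso (inv_gorder L) (inv_gorder M) f"
  by (auto simp: order_iso_def order_emb_def weak_partial_order.dual_weak_order)

lemma order_iso_sup:
  assumes "finite_lattice L" "finite_lattice M" "order_iso L M f"
    and "finite A" "A \<noteq> {}" "A \<subseteq> carrier L"
  shows "\<Squnion>\<^bsub>M\<^esub> (f ` A) = f (\<Squnion>\<^bsub>L\<^esub> A)"
  using order_iso_inf[of "inv_gorder L" "inv_gorder M" f A] assms
  by (simp add: finite_lattice_dual order_iso_dual)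

lemma lterm_value_closed:
  assumes "finite_lattice L" "range a \<subseteq> carrier L"
  shows "lterm_value L a t \<in> carrier L"
proof -
  interpret L: lattice L using assms by (simp add: finite_lattice_def)
  show ?thesis
    using assms(2)
    by (induction t) (auto intro!: L.finite_inf_closed L.finite_sup_closed)
qed

lemma lterm_value_iso:
  assumes "finite_lattice L" "finite_lattice M" "order_iso L M f" "range a \<subseteq> carrier L"
  shows "lterm_value M (f \<circ> a) t = f (lterm_value L a t)"
proof (induction t)
  case (Meet t ts)
  have ts: "lterm_value M (f \<circ> a) ` set ts = (\<lambda>x. f (lterm_value L a x)) ` set ts"
    by (rule image_cong[OF refl Meet.IH(2)])
  have "lterm_value M (f \<circ> a) (Meet t ts) =
      \<Sqinter>\<^bsub>M\<^esub> (f ` insert (lterm_value L a t) (lterm_value L a ` set ts))"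
    unfolding lterm_value.simps set_map image_insert image_image Meet.IH(1) ts ..
  also have "\<dots> = f (lterm_value L a (Meet t ts))"
    using assms lterm_value_closed[OF assms(1,4)] by (subst order_iso_inf) auto
  finally show ?case .
next
  case (Join t ts)
  have ts: "lterm_value M (f \<circ> a) ` set ts = (\<lambda>x. f (lterm_value L a x)) ` set ts"
    by (rule image_cong[OF refl Join.IH(2)])
  have "lterm_value M (f \<circ> a) (Join t ts) =
      \<Squnion>\<^bsub>M\<^esub> (f ` insert (lterm_value L a t) (lterm_value L a ` set ts))"
    unfolding lterm_value.simps set_map image_insert image_image Join.IH(1) ts ..
  also have "\<dots> = f (lterm_value L a (Join t ts))"
    using assms lterm_value_closed[OF assms(1,4)] by (subst order_iso_sup) auto
  finally show ?case .
qed simp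

lemma satisfies_iso:
  assumes LM: "finite_lattice L" "finite_lattice M" "order_iso L M f"
  shows "satisfies L q \<longleftrightarrow> satisfies M q"
proof -
  have inj: "inj_on f (carrier L)" and im: "f ` carrier L = carrier M"
    using LM by (auto simp: order_iso_def bij_betw_def)
  have eq: "equation_holds M (f \<circ> a) e \<longleftrightarrow> equation_holds L a e"
    if a: "range a \<subseteq> carrier L" for a e
    unfolding equation_holds_def lterm_value_iso[OF LM a]
    by (rule inj_on_eq_iff[OF inj lterm_value_closed[OF LM(1) a] lterm_value_closed[OF LM(1) a]])
  have onto: "\<exists>a. range a \<subseteq> carrier L \<and> b = f \<circ> a" if b: "range b \<subseteq> carrier M" for b :: "nat \<Rightarrow> _"
  proof (intro exI conjI)
    show "range (inv_into (carrier L) f \<circ> b) \<subseteq> carrier L"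
      using b unfolding im[symmetric] by (auto intro: inv_into_into)
    show "b = f \<circ> (inv_into (carrier L) f \<circ> b)"
      using b unfolding im[symmetric] by (auto simp: fun_eq_iff f_inv_into_f image_subset_iff)
  qed
  have into: "range (f \<circ> a) \<subseteq> carrier M" if "range a \<subseteq> carrier L" for a :: "nat \<Rightarrow> _"
    using that unfolding im[symmetric] by auto
  show ?thesis
  proof
    assume sL: "satisfies L q"
    show "satisfies M q"
      unfolding satisfies_def
    proof (intro allI impI)
      fix b assume b: "range b \<subseteq> carrier M"
        and prem: "\<forall>e \<in> set (qi_premises q). equation_holds M b e"
      obtain a where a: "range a \<subseteq> carrier L" "b = f \<circ> a" using onto[OF b] by blast
      have "\<forall>e \<in> set (qi_premises q). equation_holds L a e"
        using prem eq[OF a(1)] unfolding a(2) by blast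
      then have "equation_holds L a (qi_conclusion q)"
        using sL a(1) unfolding satisfies_def by blast
      then show "equation_holds M b (qi_conclusion q)"
        using eq[OF a(1)] unfolding a(2) by blast
    qed
  next
    assume sM: "satisfies M q"
    show "satisfies L q"
      unfolding satisfies_def
    proof (intro allI impI)
      fix a assume a: "range a \<subseteq> carrier L"
        and prem: "\<forall>e \<in> set (qi_premises q). equation_holds L a e"
      have "\<forall>e \<in> set (qi_premises q). equation_holds M (f \<circ> a) e"
        using prem eq[OF a] by blast
      then have "equation_holds M (f \<circ> a) (qi_conclusion q)"
        using sM into[OF a] unfolding satisfies_def by blast
      then show "equation_holds L a (qi_conclusion q)"
        using eq[OF a] by blast
    qed
  qed
qed

lemma finite_lattice_nat_copy:
  fixes L :: "'a gorder"
  assumes L: "finite_lattice L"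
  shows "\<exists>(M :: nat gorder) f. finite_lattice M \<and> order_iso L M f"
proof -
  interpret L: lattice L using L by (simp add: finite_lattice_def)
  obtain f :: "'a \<Rightarrow> nat" where inj: "inj_on f (carrier L)"
    using L finite_imp_inj_to_nat_seg unfolding finite_lattice_def by metis
  define g where "g = inv_into (carrier L) f"
  define M :: "nat gorder" where
    "M = \<lparr> carrier = f ` carrier L, eq = (=), le = (\<lambda>x y. g x \<sqsubseteq>\<^bsub>L\<^esub> g y) \<rparr>"
  have gf [simp]: "g (f x) = x" if "x \<in> carrier L" for x
    using that inj by (simp add: g_def)
  interpret M: partial_order M
    by unfold_locales (auto simp: M_def intro: L.le_trans dest: L.le_antisym)
  have up: "Upper M {f x, f y} = f ` Upper L {x, y}" and
    lo: "Lower M {f x, f y} = f ` Lower L {x, y}"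
    if "x \<in> carrier L" "y \<in> carrier L" for x y
    using that by (auto simp: Upper_def Lower_def M_def)
  have "lattice M"
  proof unfold_locales
    fix x' y' assume "x' \<in> carrier M" "y' \<in> carrier M"
    then obtain x y where xy: "x \<in> carrier L" "y \<in> carrier L" "x' = f x" "y' = f y"
      by (auto simp: M_def)
    obtain s where s: "least L s (Upper L {x, y})" using L.sup_of_two_exists xy by blast
    hence "least M (f s) (Upper M {x', y'})"
      unfolding xy(3,4) up[OF xy(1,2)] by (auto simp: least_def M_def Upper_def)
    then show "\<exists>s. least M s (Upper M {x', y'})" ..
    obtain i where i: "greatest L i (Lower L {x, y})" using L.inf_of_two_exists xy by blast
    hence "greatest M (f i) (Lower M {x', y'})"
      unfolding xy(3,4) lo[OF xy(1,2)] by (auto simp: greatest_def M_def Lower_def)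
    then show "\<exists>i. greatest M i (Lower M {x', y'})" ..
  qed
  hence "finite_lattice M" using L by (simp add: finite_lattice_def M_def)
  moreover have "order_iso L M f"
    unfolding order_iso_def order_emb_def
    using inj L.weak_partial_order_axioms M.weak_partial_order_axioms
    by (auto simp: M_def bij_betw_def)
  ultimately show ?thesis by blast
qed

lemma in_class_finite_models:
  "in_class L (finite_models \<Sigma>) \<longleftrightarrow> L \<in> finite_models \<Sigma>"
proof
  assume "in_class L (finite_models \<Sigma>)"
  then obtain M :: "nat gorder" and f where L: "finite_lattice L" and M: "finite_lattice M"
    and sat: "\<forall>q \<in> \<Sigma>. satisfies M q" and f: "order_iso L M f"
    unfolding in_class_def finite_models_def by blast
  show "L \<in> finite_models \<Sigma>"
    using L sat satisfies_iso[OF L M f] by (simp add: finite_models_def)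
next
  assume "L \<in> finite_models \<Sigma>"
  then have L: "finite_lattice L" and sat: "\<forall>q \<in> \<Sigma>. satisfies L q"
    by (simp_all add: finite_models_def)
  obtain M :: "nat gorder" and f where M: "finite_lattice M" and f: "order_iso L M f"
    using finite_lattice_nat_copy[OF L] by blast
  have "M \<in> finite_models \<Sigma>"
    using M sat satisfies_iso[OF L M f] by (simp add: finite_models_def)
  then show "in_class L (finite_models \<Sigma>)"
    using L f unfolding in_class_def by blast
qed

end

theory Submission
  imports Defs
begin

text \<open>
  Meets and joins of multichains can be taken componentwise, because componentwise meets and joins
  of multichains are again increasing.  So every projection to a component is a lattice
  homomorphism, and since a multichain is determined by its components, an equation holds under an
  assignment of multichains iff it holds under all the projected assignments.
\<close>

section \<open>Sets of lists under the entrywise order\<close>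

definition list_poset :: "'a gorder \<Rightarrow> 'a list set \<Rightarrow> 'a list gorder" where
  "list_poset P S = \<lparr> carrier = S, eq = (=), le = list_all2 (\<lambda>x y. x \<sqsubseteq>\<^bsub>P\<^esub> y) \<rparr>"

definition componentwise :: "('a set \<Rightarrow> 'a) \<Rightarrow> nat \<Rightarrow> 'a list set \<Rightarrow> 'a list" where
  "componentwise F m A = map (\<lambda>i. F ((\<lambda>xs. xs ! i) ` A)) [0..<m]"

lemma length_componentwise [simp]: "length (componentwise F m A) = m"
  by (simp add: componentwise_def)

lemma nth_componentwise [simp]: "i < m \<Longrightarrow> componentwise F m A ! i = F ((\<lambda>xs. xs ! i) ` A)"
  by (simp add: componentwise_def)

lemma carrier_list_poset [simp]: "carrier (list_poset P S) = S"
  by (simp add: list_poset_def)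

lemma le_list_poset [simp]: "xs \<sqsubseteq>\<^bsub>list_poset P S\<^esub> ys \<longleftrightarrow> list_all2 (\<lambda>x y. x \<sqsubseteq>\<^bsub>P\<^esub> y) xs ys"
  by (simp add: list_poset_def)

text \<open>This is why \<open>list_poset\<close> takes an arbitrary set \<open>S\<close>: dualising
  \<open>P\<close> keeps the same lists. \<open>multichain_poset\<close> lacks this symmetry, since
  its carrier also depends on the order of \<open>P\<close>, and dualising \<open>P\<close> would
  reverse the chains.\<close>

lemma inv_gorder_list_poset: "inv_gorder (list_poset P S) = list_poset (inv_gorder P) S"
  by (auto simp: list_poset_def list_all2_conv_all_nth fun_eq_iff)

lemma multichain_poset_eq: "multichain_poset P m = list_poset P (multichains P m)"
  by (simp add: multichain_poset_def list_poset_def)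

lemma partial_order_list_poset:
  assumes "partial_order P" and S: "S \<subseteq> lists (carrier P)"
  shows "partial_order (list_poset P S)"
proof -
  interpret P: partial_order P by fact
  have c: "xs ! i \<in> carrier P" if "xs \<in> S" "i < length xs" for xs i
    using S that by (meson in_listsD nth_mem subsetD)
  show ?thesis
  proof unfold_locales
    fix xs ys assume "xs \<sqsubseteq>\<^bsub>list_poset P S\<^esub> ys" "ys \<sqsubseteq>\<^bsub>list_poset P S\<^esub> xs"
      "xs \<in> carrier (list_poset P S)" "ys \<in> carrier (list_poset P S)"
    \<comment> \<open>\<open>list_all2\<close> forces equal lengths, so antisymmetry in each entry
      gives equality of the lists.\<close>
    then show "xs .=\<^bsub>list_poset P S\<^esub> ys"
      using c by (auto simp: list_poset_def list_all2_conv_all_nth intro!: nth_equalityI P.le_antisym)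
  next
    fix xs ys zs assume "xs \<sqsubseteq>\<^bsub>list_poset P S\<^esub> ys" "ys \<sqsubseteq>\<^bsub>list_poset P S\<^esub> zs"
      "xs \<in> carrier (list_poset P S)" "ys \<in> carrier (list_poset P S)" "zs \<in> carrier (list_poset P S)"
    then show "xs \<sqsubseteq>\<^bsub>list_poset P S\<^esub> zs"
      using c by (auto simp: list_all2_conv_all_nth) (metis P.le_trans)
  qed (use c in \<open>auto simp: list_poset_def list_all2_conv_all_nth\<close>)
qed

text \<open>Bounds in the entrywise order can be checked one index at a time. What ties the entries
  together is membership in \<open>S\<close>, and for the candidate this is supplied by
  \<open>closed\<close>.\<close>

lemma greatest_componentwise_inf:
  assumes "lattice P" and S: "S \<subseteq> lists (carrier P)" and len: "\<And>xs. xs \<in> S \<Longrightarrow> length xs = m"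
    and A: "finite A" "A \<noteq> {}" "A \<subseteq> S" and closed: "componentwise (Lattice.inf P) m A \<in> S"
  shows "greatest (list_poset P S) (componentwise (Lattice.inf P) m A) (Lower (list_poset P S) A)"
proof -
  interpret P: lattice P by fact
  have lenA: "length xs = m" if "xs \<in> A" for xs using that len A by blast
  have c: "xs ! i \<in> carrier P" if "xs \<in> S" "i < m" for xs i
    using S len that by (metis in_listsD nth_mem subsetD)
  have g: "greatest P (\<Sqinter>\<^bsub>P\<^esub> ((\<lambda>xs. xs ! i) ` A)) (Lower P ((\<lambda>xs. xs ! i) ` A))" if "i < m" for i
    using A c that by (intro P.finite_inf_greatest) auto
  show ?thesis
  proof (rule greatest_LowerI)
    fix xs assume xs: "xs \<in> A"
    have "\<Sqinter>\<^bsub>P\<^esub> ((\<lambda>xs. xs ! i) ` A) \<sqsubseteq>\<^bsub>P\<^esub> xs ! i" if "i < m" for i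
      using greatest_Lower_below[OF g[OF that], of "xs ! i"] xs A c that by blast
    then show "componentwise (Lattice.inf P) m A \<sqsubseteq>\<^bsub>list_poset P S\<^esub> xs"
      using lenA[OF xs] by (simp add: list_all2_conv_all_nth)
  next
    fix ys assume ys: "ys \<in> Lower (list_poset P S) A"
    then have ysS: "ys \<in> S" and le: "\<And>xs. xs \<in> A \<Longrightarrow> list_all2 (\<lambda>x y. x \<sqsubseteq>\<^bsub>P\<^esub> y) ys xs"
      using A by (auto simp: Lower_def)
    have "ys ! i \<sqsubseteq>\<^bsub>P\<^esub> \<Sqinter>\<^bsub>P\<^esub> ((\<lambda>xs. xs ! i) ` A)" if i: "i < m" for i
    proof (rule greatest_le[OF g[OF i]])
      show "ys ! i \<in> Lower P ((\<lambda>xs. xs ! i) ` A)"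
        using le c[OF ysS i] i len[OF ysS] by (auto intro!: Lower_memI simp: list_all2_conv_all_nth)
    qed
    then show "ys \<sqsubseteq>\<^bsub>list_poset P S\<^esub> componentwise (Lattice.inf P) m A"
      using len[OF ysS] by (simp add: list_all2_conv_all_nth)
  qed (use A closed in auto)
qed

text \<open>Order dual of the preceding lemma: the meet of \<open>inv_gorder P\<close> is the join
  of \<open>P\<close>, while \<open>S\<close> stays fixed.\<close>

lemma least_componentwise_sup:
  assumes "lattice P" "S \<subseteq> lists (carrier P)" "\<And>xs. xs \<in> S \<Longrightarrow> length xs = m"
    and "finite A" "A \<noteq> {}" "A \<subseteq> S" "componentwise (Lattice.sup P) m A \<in> S"
  shows "least (list_poset P S) (componentwise (Lattice.sup P) m A) (Upper (list_poset P S) A)"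
proof -
  have "lattice (inv_gorder P)"
    by (rule lattice.dual_lattice[OF assms(1)])
  moreover have "Lattice.inf (inv_gorder P) = Lattice.sup P" by (simp add: fun_eq_iff)
  ultimately have "greatest (list_poset (inv_gorder P) S) (componentwise (Lattice.sup P) m A)
      (Lower (list_poset (inv_gorder P) S) A)"
    using greatest_componentwise_inf[of "inv_gorder P" S m A] assms by simp
  then show ?thesis
    unfolding inv_gorder_list_poset[symmetric] Lower_dual greatest_dual .
qed

section \<open>Multichains and their componentwise meets and joins\<close>

lemma inf_image_mono:
  assumes "lattice P" and A: "finite A" "A \<noteq> {}" "f ` A \<subseteq> carrier P" "g ` A \<subseteq> carrier P"
    and le: "\<And>x. x \<in> A \<Longrightarrow> f x \<sqsubseteq>\<^bsub>P\<^esub> g x"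
  shows "\<Sqinter>\<^bsub>P\<^esub> (f ` A) \<sqsubseteq>\<^bsub>P\<^esub> \<Sqinter>\<^bsub>P\<^esub> (g ` A)"
proof -
  interpret P: lattice P by fact
  have f: "greatest P (\<Sqinter>\<^bsub>P\<^esub> (f ` A)) (Lower P (f ` A))"
    and g: "greatest P (\<Sqinter>\<^bsub>P\<^esub> (g ` A)) (Lower P (g ` A))"
    using A by (auto intro!: P.finite_inf_greatest)
  have c: "\<Sqinter>\<^bsub>P\<^esub> (f ` A) \<in> carrier P" using f by simp
  \<comment> \<open>The meet of the \<open>f\<close>-values lies below each \<open>f x\<close>,
    hence below \<open>g x\<close>, so it is a lower bound of the \<open>g\<close>-values.\<close>
  have "\<Sqinter>\<^bsub>P\<^esub> (f ` A) \<sqsubseteq>\<^bsub>P\<^esub> g x" if x: "x \<in> A" for x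
    using greatest_Lower_below[OF f, of "f x"] le[OF x] x A c
    by (meson P.le_trans image_eqI image_subset_iff)
  then show ?thesis
    using c by (intro greatest_le[OF g] Lower_memI) auto
qed

lemma sup_image_mono:
  assumes "lattice P" "finite A" "A \<noteq> {}" "f ` A \<subseteq> carrier P" "g ` A \<subseteq> carrier P"
    and "\<And>x. x \<in> A \<Longrightarrow> f x \<sqsubseteq>\<^bsub>P\<^esub> g x"
  shows "\<Squnion>\<^bsub>P\<^esub> (f ` A) \<sqsubseteq>\<^bsub>P\<^esub> \<Squnion>\<^bsub>P\<^esub> (g ` A)"
  \<comment> \<open>The comparison is reversed in the dual lattice, so \<open>f\<close> and
    \<open>g\<close> trade places.\<close>
  using inf_image_mono[OF lattice.dual_lattice[OF assms(1)], of A g f] assms(2-) by simp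

lemma multichains_iff:
  "xs \<in> multichains P m \<longleftrightarrow>
    length xs = m \<and> (\<forall>i<m. xs ! i \<in> carrier P) \<and> (\<forall>i. Suc i < m \<longrightarrow> xs ! i \<sqsubseteq>\<^bsub>P\<^esub> xs ! Suc i)"
  by (auto simp: multichains_def successively_conv_nth in_set_conv_nth subset_iff)

lemma finite_multichains: "finite (carrier P) \<Longrightarrow> finite (multichains P m)"
  by (rule finite_subset[OF _ finite_lists_length_eq[of _ m]]) (auto simp: multichains_def)

context
  fixes P :: "'a gorder" and m :: nat
  assumes P: "finite_lattice P"
begin

interpretation P: lattice P
  using P by (simp add: finite_lattice_def)

text \<open>Monotonicity is applied with \<open>f\<close> and \<open>g\<close> the projections to
  the neighbouring indices \<open>i\<close> and \<open>Suc i\<close>.\<close>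

lemma multichain_componentwise:
  assumes A: "A \<subseteq> multichains P m" "A \<noteq> {}"
  shows "componentwise (Lattice.inf P) m A \<in> multichains P m"
    and "componentwise (Lattice.sup P) m A \<in> multichains P m"
proof -
  \<comment> \<open>A lattice guarantees meets and joins of finite nonempty sets; finiteness of
    \<open>P\<close> makes every set of multichains finite.\<close>
  have fin: "finite A"
    using A P finite_multichains finite_subset unfolding finite_lattice_def by blast
  have c: "xs ! i \<in> carrier P" if "xs \<in> A" "i < m" for i xs
    using A that by (auto simp: multichains_iff)
  have le: "xs ! i \<sqsubseteq>\<^bsub>P\<^esub> xs ! Suc i" if "xs \<in> A" "Suc i < m" for i xs
    using A that by (auto simp: multichains_iff)
  show "componentwise (Lattice.inf P) m A \<in> multichains P m"
    unfolding multichains_iff using A fin c le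
    by (auto intro!: P.finite_inf_closed inf_image_mono[OF P.lattice_axioms])
  show "componentwise (Lattice.sup P) m A \<in> multichains P m"
    unfolding multichains_iff using A fin c le
    by (auto intro!: P.finite_sup_closed sup_image_mono[OF P.lattice_axioms])
qed

text \<open>Stated for every nonempty \<open>A\<close>: pairs yield the lattice property, and larger
  sets are needed for terms with meets and joins of any finite arity.\<close>

lemma multichain_poset_bounds:
  assumes A: "A \<subseteq> multichains P m" "A \<noteq> {}"
  shows "greatest (multichain_poset P m) (componentwise (Lattice.inf P) m A) (Lower (multichain_poset P m) A)"
    and "least (multichain_poset P m) (componentwise (Lattice.sup P) m A) (Upper (multichain_poset P m) A)"
proof -
  have fin: "finite A"
    using A P finite_multichains finite_subset unfolding finite_lattice_def by blast
  have S: "multichains P m \<subseteq> lists (carrier P)"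
    and len: "\<And>xs. xs \<in> multichains P m \<Longrightarrow> length xs = m"
    by (auto simp: multichains_def)
  show "greatest (multichain_poset P m) (componentwise (Lattice.inf P) m A) (Lower (multichain_poset P m) A)"
    unfolding multichain_poset_eq
    by (rule greatest_componentwise_inf[OF P.lattice_axioms S len fin A(2,1)
          multichain_componentwise(1)[OF A]])
  show "least (multichain_poset P m) (componentwise (Lattice.sup P) m A) (Upper (multichain_poset P m) A)"
    unfolding multichain_poset_eq
    by (rule least_componentwise_sup[OF P.lattice_axioms S len fin A(2,1)
          multichain_componentwise(2)[OF A]])
qed

lemma finite_lattice_multichain_poset: "finite_lattice (multichain_poset P m)"
proof -
  have "multichains P m \<subseteq> lists (carrier P)" by (auto simp: multichains_def)
  then interpret M: partial_order "multichain_poset P m"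
    unfolding multichain_poset_eq by (rule partial_order_list_poset[OF P.partial_order_axioms])
  have "lattice (multichain_poset P m)"
  proof unfold_locales
    fix xs ys assume "xs \<in> carrier (multichain_poset P m)" "ys \<in> carrier (multichain_poset P m)"
    then have "{xs, ys} \<subseteq> multichains P m" "{xs, ys} \<noteq> {}" by (auto simp: multichain_poset_eq)
    from multichain_poset_bounds[OF this]
    show "\<exists>s. least (multichain_poset P m) s (Upper (multichain_poset P m) {xs, ys})"
      and "\<exists>s. greatest (multichain_poset P m) s (Lower (multichain_poset P m) {xs, ys})"
      by blast+
  qed
  then show ?thesis
    using P finite_multichains by (auto simp: finite_lattice_def multichain_poset_eq)
qed

text \<open>The meet and join operators choose some greatest lower and least upper bound; uniqueness
  of such bounds identifies the choice with the explicit componentwise list.\<close>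

lemma multichain_poset_inf_sup:
  assumes A: "A \<subseteq> multichains P m" "A \<noteq> {}"
  shows "\<Sqinter>\<^bsub>multichain_poset P m\<^esub> A = componentwise (Lattice.inf P) m A"
    and "\<Squnion>\<^bsub>multichain_poset P m\<^esub> A = componentwise (Lattice.sup P) m A"
proof -
  interpret M: lattice "multichain_poset P m"
    using finite_lattice_multichain_poset by (simp add: finite_lattice_def)
  have fin: "finite A"
    using A P finite_multichains finite_subset unfolding finite_lattice_def by blast
  have A': "A \<subseteq> carrier (multichain_poset P m)" using A by (simp add: multichain_poset_eq)
  show "\<Sqinter>\<^bsub>multichain_poset P m\<^esub> A = componentwise (Lattice.inf P) m A"
    using M.greatest_unique M.finite_inf_greatest[OF fin A' A(2)] multichain_poset_bounds(1)[OF A]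
    by blast
  show "\<Squnion>\<^bsub>multichain_poset P m\<^esub> A = componentwise (Lattice.sup P) m A"
    using M.least_unique M.finite_sup_least[OF fin A' A(2)] multichain_poset_bounds(2)[OF A]
    by blast
qed

section \<open>Evaluation of terms and quasi-identities in components\<close>

lemma lterm_value_multichain_nth:
  assumes a: "range a \<subseteq> carrier (multichain_poset P m)" and i: "i < m"
  shows "lterm_value (multichain_poset P m) a t ! i = lterm_value P (\<lambda>n. a n ! i) t"
proof -
  let ?v = "lterm_value (multichain_poset P m) a"
  have sub: "insert (?v t) (?v ` set ts) \<subseteq> multichains P m" for t ts
    using lterm_value_closed[OF finite_lattice_multichain_poset a] by (auto simp: multichain_poset_eq)
  \<comment> \<open>Projecting the arguments of a meet or join gives the arguments of the same
    operation in \<open>P\<close>. The induction hypotheses enter as premises, so both inductive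
    cases can use this fact.\<close>
  have im: "(\<lambda>xs. xs ! i) ` insert (?v t) (?v ` set ts) =
      insert (lterm_value P (\<lambda>n. a n ! i) t) (lterm_value P (\<lambda>n. a n ! i) ` set ts)"
    if "?v t ! i = lterm_value P (\<lambda>n. a n ! i) t"
      and "\<And>u. u \<in> set ts \<Longrightarrow> ?v u ! i = lterm_value P (\<lambda>n. a n ! i) u" for t ts
    using that by (simp add: image_image)
  show ?thesis
  proof (induction t)
    case (Meet t ts)
    show ?case
      unfolding lterm_value.simps set_map multichain_poset_inf_sup[OF sub insert_not_empty]
        nth_componentwise[OF i]
      by (rule arg_cong[OF im[OF Meet.IH]])
  next
    case (Join t ts)
    show ?case
      unfolding lterm_value.simps set_map multichain_poset_inf_sup[OF sub insert_not_empty]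
        nth_componentwise[OF i]
      by (rule arg_cong[OF im[OF Join.IH]])
  qed simp
qed

lemma equation_holds_multichain_poset:
  assumes a: "range a \<subseteq> carrier (multichain_poset P m)"
  shows "equation_holds (multichain_poset P m) a e \<longleftrightarrow>
    (\<forall>i<m. equation_holds P (\<lambda>n. a n ! i) e)"
proof -
  \<comment> \<open>Entrywise agreement gives equality of lists only once their lengths
    agree.\<close>
  have "length (lterm_value (multichain_poset P m) a t) = m" for t
    using lterm_value_closed[OF finite_lattice_multichain_poset a]
    by (auto simp: multichain_poset_eq multichains_def)
  then show ?thesis
    by (auto simp: equation_holds_def list_eq_iff_nth_eq lterm_value_multichain_nth[OF a])
qed

text \<open>Premises valid for multichains descend to every component; \<open>q\<close> gives the
  conclusion in each one, and these recombine. In effect, quasi-identities pass to sublattices of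
  the power of \<open>P\<close> with exponent \<open>m\<close>.\<close>

lemma satisfies_multichain_poset:
  assumes "satisfies P q"
  shows "satisfies (multichain_poset P m) q"
  unfolding satisfies_def
proof (intro allI impI)
  fix a assume a: "range a \<subseteq> carrier (multichain_poset P m)"
    and prem: "\<forall>e \<in> set (qi_premises q). equation_holds (multichain_poset P m) a e"
  have "equation_holds P (\<lambda>n. a n ! i) (qi_conclusion q)" if i: "i < m" for i
  proof -
    have "range (\<lambda>n. a n ! i) \<subseteq> carrier P"
      using a i by (auto simp: multichain_poset_eq multichains_iff)
    moreover have "\<forall>e \<in> set (qi_premises q). equation_holds P (\<lambda>n. a n ! i) e"
      using prem i by (simp add: equation_holds_multichain_poset[OF a])
    ultimately show ?thesis
      using assms by (simp add: satisfies_def)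
  qed
  then show "equation_holds (multichain_poset P m) a (qi_conclusion q)"
    by (simp add: equation_holds_multichain_poset[OF a])
qed

end

theorem theorem2p20:
  fixes K :: lattice_class and P :: "'a gorder" and m :: nat
  assumes "variety K \<or> quasi_variety K"
    and "in_class P K"
    and "m > 0"
  shows "in_class (multichain_poset P m) K"
proof -
  \<comment> \<open>Identities are quasi-identities with no premises, so both cases reduce to a
    defining set \<open>\<Sigma>\<close>.\<close>
  obtain \<Sigma> where K: "K = finite_models \<Sigma>"
    using assms(1) by (auto simp: variety_def quasi_variety_def)
  \<comment> \<open>\<open>in_class_finite_models\<close> trades membership up to isomorphism for
    satisfaction of \<open>\<Sigma>\<close>, here over \<open>'a\<close> and below over
    \<open>'a list\<close>.\<close>
  have "finite_lattice P" "\<forall>q \<in> \<Sigma>. satisfies P q"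
    using assms(2) unfolding K in_class_finite_models by (simp_all add: finite_models_def)
  then show ?thesis
    unfolding K in_class_finite_models unfolding finite_models_def
    using finite_lattice_multichain_poset[of P] satisfies_multichain_poset[of P] by blast
qed

end
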